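(* Let $P_0$ be a probability measure on a measurable space $\mathcal X$, let $X$ denote an $\mathcal X$-valued random variable, and let $h:\mathcal X\to\mathbb R$ be measurable. Assume: (i) there is $r>0$ such that $E_0[e^{\theta h(X)}]<\infty$ for all $\theta\in(-r,r)$; (ii) the random variable $h(X)$ is non-constant under $P_0$. For $\eta>0$ consider the optimization problem $$\max\ E_f[h(X)]\quad\text{subject to}\quad D(P_f\|P_0)\le\eta,\ X\sim P_f,\ P_f\in\mathcal P_0,$$ where the decision variable is the probability measure $P_f$. Let $\psi(\beta)=\log E_0[e^{\beta h(X)}]$. Then for all $\eta>0$ in a sufficiently small neighborhood of $0$, the optimal value is $$\max E_f[h(X)]=\psi'(\beta^* ),$$ where $\beta^*$ is the unique positive solution of the equation $\beta\psi'(\beta)-\psi(\beta)=\eta$. Consequently, as $\eta\to0^+$, $$\max E_f[h(X)]=E_0[h(X)]+\sqrt{2\,Var_0(h(X))}\,\eta^{1/2}+\frac13\,\frac{\kappa_3(h(X))}{Var_0(h(X))}\,\eta+O(\eta^{3/2}),$$ where $Var_0(h(X))=E_0[(h(X)-E_0[h(X)])^2]$ and $\kappa_3(h(X))=E_0[(h(X)-E_0[h(X)])^3]$.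
   Context: $E_0$ denotes expectation when $X\sim P_0$, and $E_f$ denotes expectation when $X\sim P_f$. $\mathcal P_0$ is the set of all probability measures on $\mathcal X$ that are absolutely continuous with respect to $P_0$. The Kullback-Leibler divergence is $D(P_f\|P_0)=\int\log\frac{dP_f}{dP_0}\,dP_f=E_0\big[\frac{dP_f}{dP_0}\log\frac{dP_f}{dP_0}\big]$ (with $0\log 0=0$). *)

theory Defs
  imports "HOL-Probability.Probability" "HOL-Library.Landau_Symbols"
begin

text \<open>
  Kullback--Leibler divergence of \<open>Q\<close> from \<open>P\<close> in nats, for probability measures with
  \<open>Q\<close> absolutely continuous with respect to \<open>P\<close>. The Bochner integral underlying
  \<open>KL_divergence\<close> is 0 for non-integrable functions. The negative part of
  \<open>ln (dQ/dP)\<close> is always \<open>Q\<close>-integrable, so non-integrability means that the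
  divergence is infinite.
\<close>
definition KL_div :: "'a measure \<Rightarrow> 'a measure \<Rightarrow> ereal" where
  "KL_div Q P =
     (if integrable Q (entropy_density (exp 1) P Q)
      then ereal (KL_divergence (exp 1) P Q) else \<infinity>)"

definition ac_prob_measures :: "'a measure \<Rightarrow> 'a measure set" where
  "ac_prob_measures P0 = {P. sets P = sets P0 \<and> prob_space P \<and> absolutely_continuous P0 P}"

definition KL_ball :: "'a measure \<Rightarrow> real \<Rightarrow> 'a measure set" where
  "KL_ball P0 \<eta> = {P \<in> ac_prob_measures P0. KL_div P P0 \<le> ereal \<eta>}"

text \<open>Meaningful only if the maximum is attained and \<open>h\<close> is integrable under every
  feasible measure.\<close>
definition max_expectation :: "'a measure \<Rightarrow> ('a \<Rightarrow> real) \<Rightarrow> real \<Rightarrow> real" where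
  "max_expectation P0 h \<eta> = (GREATEST v. v \<in> (\<lambda>P. integral\<^sup>L P h) ` KL_ball P0 \<eta>)"

definition log_mgf :: "'a measure \<Rightarrow> ('a \<Rightarrow> real) \<Rightarrow> real \<Rightarrow> real" where
  "log_mgf P0 h \<beta> = ln (\<integral>x. exp (\<beta> * h x) \<partial>P0)"

definition log_mgf_domain :: "'a measure \<Rightarrow> ('a \<Rightarrow> real) \<Rightarrow> real set" where
  "log_mgf_domain P0 h = {\<beta>. integrable P0 (\<lambda>x. exp (\<beta> * h x))}"

text \<open>Positive solutions of \<open>\<beta> \<psi>'(\<beta>) - \<psi>(\<beta>) = \<eta>\<close> for \<open>\<psi> = log_mgf P0 h\<close>. The equation
  presupposes that \<open>\<psi>\<close> is finite around \<open>\<beta>\<close>. Outside its domain \<open>log_mgf\<close> takes the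
  junk value \<open>ln 0\<close>.\<close>
definition tilt_solution :: "'a measure \<Rightarrow> ('a \<Rightarrow> real) \<Rightarrow> real \<Rightarrow> real \<Rightarrow> bool" where
  "tilt_solution P0 h \<eta> \<beta> \<longleftrightarrow>
     0 < \<beta> \<and> \<beta> \<in> interior (log_mgf_domain P0 h) \<and>
     \<beta> * deriv (log_mgf P0 h) \<beta> - log_mgf P0 h \<beta> = \<eta>"

definition central_moment :: "'a measure \<Rightarrow> ('a \<Rightarrow> real) \<Rightarrow> nat \<Rightarrow> real" where
  "central_moment P0 h k = (\<integral>x. (h x - integral\<^sup>L P0 h) ^ k \<partial>P0)"

end

theory Submission
  imports Defs
begin

text \<open>
  Let \<open>psi\<close> be the cumulant generating function of \<open>h\<close>. On the interior of its domain,
  differentiation under the integral (\<open>exp_moment_has_derivative\<close>) shows that \<open>psi\<close> is smooth,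
  that \<open>psi' \<beta>\<close> is the mean of \<open>h\<close> under the exponentially tilted measure with density
  \<open>exp (\<beta> h - psi \<beta>)\<close>, and that \<open>psi'' \<beta>\<close> is its variance under this measure.

  The optimization problem is solved by duality. For every \<open>P\<close> in the ball of radius \<open>\<eta>\<close> and every
  \<open>\<beta>\<close> in this interior, the inequality of Donsker and Varadhan gives
  \<open>\<beta> E\<^sub>P[h] \<le> D(P, P\<^sub>0) + psi \<beta> \<le> \<eta> + psi \<beta>\<close> (\<open>donsker_varadhan\<close>). The tilted measure attains
  equality in the first step, and its divergence is \<open>\<beta> psi' \<beta> - psi \<beta>\<close>. If this number is
  \<open>\<eta>\<close>, then the second step is an equality as well, so the tilted measure is a maximizer and the
  optimal value is \<open>psi' \<beta>\<close> (\<open>tilted_measure_optimal\<close>).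

  The function \<open>\<beta> psi' \<beta> - psi \<beta>\<close> vanishes at 0 and has derivative \<open>\<beta> psi'' \<beta>\<close>, which is
  positive for \<open>\<beta> > 0\<close> because \<open>h\<close> is not constant. Hence it is strictly increasing
  (\<open>tilted_KL_strict_mono\<close>), and for small \<open>\<eta>\<close> the intermediate value theorem gives exactly one
  positive solution, which lies near 0 (\<open>tilt_solution_exists\<close>).

  For the expansion, write \<open>k2\<close> and \<open>k3\<close> for the second and third central moments. Taylor's
  formula gives \<open>psi' \<beta> = E[h] + k2 \<beta> + k3 \<beta>\<^sup>2 / 2 + O(\<beta>\<^sup>3)\<close> and
  \<open>\<eta> = k2 \<beta>\<^sup>2 / 2 + k3 \<beta>\<^sup>3 / 3 + O(\<beta>\<^sup>4)\<close> (\<open>taylor_bounds\<close>); eliminating \<open>\<beta>\<close> between the two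
  (\<open>parametric_sqrt_expansion\<close>) expresses the optimal value through \<open>\<eta>\<close>.
\<close>

section \<open>Elementary inequalities\<close>

lemma power_le_exp: 
  fixes x :: real assumes "0 \<le> x" shows "x ^ k \<le> real k ^ k * exp x"
proof (cases "k = 0")
  case True then show ?thesis using assms by simp
next
  case False
  then have k: "0 < real k" by simp
  have "x / k \<le> exp (x / k)" using exp_ge_add_one_self[of "x / k"] by linarith
  then have "(x / k) ^ k \<le> exp (x / k) ^ k" using assms by (intro power_mono) auto
  also have "\<dots> = exp x" using k by (simp flip: exp_of_nat_mult)
  finally show ?thesis using k by (simp add: power_divide field_simps)
qed

lemma exp_mult_le_endpoints:
  fixes s t u y :: real assumes "s \<le> t" "t \<le> u"
  shows "exp (t * y) \<le> exp (s * y) + exp (u * y)"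
proof (cases "0 \<le> y")
  case True
  then have "exp (t * y) \<le> exp (u * y)" using assms by (simp add: mult_right_mono)
  then show ?thesis by (simp add: add.commute add_increasing)
next
  case False
  then have "exp (t * y) \<le> exp (s * y)" using assms by (simp add: mult_right_mono_neg)
  then show ?thesis by (simp add: add_increasing2)
qed

lemma abs_exp_diff_le:
  fixes a b :: real shows "\<bar>exp a - exp b\<bar> \<le> \<bar>a - b\<bar> * max (exp a) (exp b)"
proof -
  have *: "exp v - exp u \<le> (v - u) * exp v" for u v :: real
  proof -
    have "1 - exp (u - v) \<le> v - u" using exp_ge_add_one_self[of "u - v"] by linarith
    then have "(1 - exp (u - v)) * exp v \<le> (v - u) * exp v" by (intro mult_right_mono) auto
    then show ?thesis by (simp add: exp_diff algebra_simps)
  qed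
  show ?thesis
    using *[of a b] *[of b a] by (cases "a \<le> b") (auto simp: max_def abs_if algebra_simps)
qed

text \<open>
  Young's inequality for the conjugate pair \<open>f ln f - f\<close> and \<open>exp y\<close>, with equality at
  \<open>y = ln f\<close>. It follows from \<open>1 + z \<le> exp z\<close> at \<open>z = y - ln f\<close>, and it is the pointwise
  source of all upper bounds on expectations over a divergence ball.
\<close>

lemma entropy_exp_young:
  fixes f y :: real assumes "0 \<le> f"
  shows "f * y \<le> f * ln f - f + exp y"
proof (cases "f = 0")
  case False
  then have f: "0 < f" using assms by simp
  have "1 + (y - ln f) \<le> exp (y - ln f)" by (rule exp_ge_add_one_self)
  then have "f * (1 + (y - ln f)) \<le> f * exp (y - ln f)" using f by (intro mult_left_mono) auto
  also have "\<dots> = exp y" using f by (simp add: exp_diff)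
  finally show ?thesis by (simp add: algebra_simps)
qed simp

section \<open>Eliminating the parameter from two expansions\<close>

text \<open>
  Given expansions of \<open>u\<close> and \<open>g\<close> in a small parameter \<open>\<beta>\<close>, this expresses \<open>u\<close> through \<open>g\<close>
  without inverting the second expansion. Put \<open>A = 2 k2 g\<close> and \<open>B = k2 \<beta> + k3 \<beta>\<^sup>2 / 3\<close>. Squaring
  shows \<open>A - B\<^sup>2 = O(\<beta>\<^sup>4)\<close>, and \<open>sqrt A + B\<close> is at least a multiple of \<open>\<beta>\<close>, so that
  \<open>sqrt A - B = (A - B\<^sup>2) / (sqrt A + B) = O(\<beta>\<^sup>3)\<close>. The remaining \<open>\<beta>\<^sup>2\<close> terms of
  \<open>u - sqrt A - k3 g / (3 k2)\<close> cancel, because \<open>1/2 - 1/3 - 1/6 = 0\<close>. Finally \<open>\<beta>\<^sup>2 \<le> 4 g / k2\<close> turns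
  \<open>O(\<beta>\<^sup>3)\<close> into \<open>O(g powr (3/2))\<close>. The constants depend on \<open>k2\<close>, \<open>k3\<close> and \<open>K\<close> alone, so the
  bound holds uniformly along a curve \<open>\<beta> \<mapsto> (u, g)\<close>.
\<close>

lemma parametric_sqrt_expansion:
  fixes k2 k3 K :: real
  assumes k2: "0 < k2" and K: "0 \<le> K"
  shows "\<exists>C. \<exists>b>0. \<forall>\<beta> u g. 0 < \<beta> \<and> \<beta> \<le> b \<and>
    \<bar>u - (k2 * \<beta> + k3 / 2 * \<beta>^2)\<bar> \<le> K * \<beta>^3 \<and>
    \<bar>g - (k2 / 2 * \<beta>^2 + k3 / 3 * \<beta>^3)\<bar> \<le> K * \<beta>^4 \<longrightarrow>
    \<bar>u - (sqrt (2 * k2) * g powr (1/2) + 1/3 * (k3 / k2) * g)\<bar> \<le> C * g powr (3/2)"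
proof -
  \<comment> \<open>For \<open>\<beta> \<le> b\<close> the higher-order terms of \<open>g\<close> take away at most half of \<open>k2 / 2 * \<beta>\<^sup>2\<close>.\<close>
  define b where "b = min 1 (k2 / (4 * (\<bar>k3\<bar> + K + 1)))"
  define C1 where "C1 = (2 * k2 * K + k3^2 / 9) / (k2 / 2)"
  define C2 where "C2 = K + C1 + \<bar>k3\<bar> / (3 * k2) * (\<bar>k3\<bar> / 3 + K)"
  have b: "0 < b" using k2 K unfolding b_def by (auto intro!: divide_pos_pos add_nonneg_pos)
  have C1: "0 \<le> C1" unfolding C1_def using k2 K by auto
  have C2: "0 \<le> C2" unfolding C2_def using k2 K C1 by auto
  have main: "\<bar>u - (sqrt (2 * k2) * g powr (1/2) + 1/3 * (k3 / k2) * g)\<bar> 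
      \<le> C2 * (4 / k2) powr (3/2) * g powr (3/2)"
    if \<beta>: "0 < \<beta>" "\<beta> \<le> b" and u: "\<bar>u - (k2 * \<beta> + k3 / 2 * \<beta>^2)\<bar> \<le> K * \<beta>^3"
      and g: "\<bar>g - (k2 / 2 * \<beta>^2 + k3 / 3 * \<beta>^3)\<bar> \<le> K * \<beta>^4" for \<beta> u g
  proof -
    have \<beta>1: "\<beta> \<le> 1" using \<beta> by (simp add: b_def)
    have "\<beta> \<le> k2 / (4 * (\<bar>k3\<bar> + K + 1))" using \<beta> by (simp add: b_def)
    then have small: "(\<bar>k3\<bar> + K + 1) * \<beta> \<le> k2 / 4"
      using K by (simp add: field_simps add_nonneg_pos pos_le_divide_eq)
    have k3\<beta>: "\<bar>k3\<bar> * \<beta> \<le> k2 / 4" and k3K: "\<bar>k3\<bar> * \<beta> + K * \<beta> \<le> k2 / 4"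
      using small K \<beta> by (auto simp: algebra_simps intro: order_trans[rotated])
    have "\<bar>k3 * \<beta>\<bar> \<le> k2 / 4" using k3\<beta> \<beta> by (simp add: abs_mult)
    then have k3l: "- (k2/4) \<le> k3 * \<beta>" by (simp add: abs_le_iff)
    define B where "B = k2 * \<beta> + k3 / 3 * \<beta>^2"
    have Beq: "B = \<beta> * (k2 + k3 * \<beta> / 3)" by (simp add: B_def power2_eq_square algebra_simps)
    have Blo: "k2 / 2 * \<beta> \<le> B"
    proof -
      have "k2 / 2 \<le> k2 + k3 * \<beta> / 3" using k3l k2 by simp
      then have "\<beta> * (k2 / 2) \<le> \<beta> * (k2 + k3 * \<beta> / 3)" using \<beta> by (intro mult_left_mono) auto
      then show ?thesis unfolding Beq by (simp add: mult.commute)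
    qed
    have p43: "\<beta>^4 \<le> \<beta>^3" using \<beta> \<beta>1 by (intro power_decreasing) auto
    have glo: "k2 / 4 * \<beta>^2 \<le> g"
    proof -
      have "\<bar>k3 / 3 * \<beta>^3\<bar> + K * \<beta>^4 \<le> \<bar>k3\<bar> * \<beta>^3 + K * \<beta>^3"
        using \<beta> K p43 by (intro add_mono mult_left_mono) (auto simp: abs_mult)
      also have "\<dots> = (\<bar>k3\<bar> * \<beta> + K * \<beta>) * \<beta>^2" by (simp add: power3_eq_cube power2_eq_square algebra_simps)
      also have "\<dots> \<le> k2 / 4 * \<beta>^2" using k3K by (intro mult_right_mono) auto
      finally show ?thesis using g by (simp add: abs_if split: if_splits)
    qed
    have gpos: "0 < g" using glo k2 \<beta> by (meson divide_pos_pos less_le_trans mult_pos_pos zero_less_numeral zero_less_power)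
    define A where "A = 2 * k2 * g"
    have Apos: "0 < A" using gpos k2 by (simp add: A_def)
    have AB: "\<bar>A - B^2\<bar> \<le> (2 * k2 * K + k3^2 / 9) * \<beta>^4"
    proof -
      have "A - B^2 = 2 * k2 * (g - (k2 / 2 * \<beta>^2 + k3 / 3 * \<beta>^3)) - k3^2 / 9 * \<beta>^4"
        unfolding A_def B_def by (simp add: field_simps power2_eq_square power3_eq_cube power4_eq_xxxx)
      also have "\<bar>\<dots>\<bar> \<le> \<bar>2 * k2 * (g - (k2 / 2 * \<beta>^2 + k3 / 3 * \<beta>^3))\<bar> + \<bar>k3^2 / 9 * \<beta>^4\<bar>" 
        by (rule abs_triangle_ineq4)
      also have "\<dots> \<le> 2 * k2 * (K * \<beta>^4) + k3^2 / 9 * \<beta>^4"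
        using g k2 by (auto simp: abs_mult intro!: add_mono mult_left_mono)
      finally show ?thesis by (simp add: algebra_simps)
    qed
    have sB: "\<bar>sqrt A - B\<bar> \<le> C1 * \<beta>^3"
    proof -
      have "\<bar>sqrt A - B\<bar> * (k2 / 2 * \<beta>) \<le> \<bar>sqrt A - B\<bar> * (sqrt A + B)"
        using Blo Apos by (intro mult_left_mono) (auto simp: add_increasing)
      also have "\<dots> = \<bar>(sqrt A - B) * (sqrt A + B)\<bar>"
        using Blo Apos k2 \<beta> by (subst abs_mult) (simp add: add_nonneg_nonneg order_trans[OF _ Blo])
      also have "(sqrt A - B) * (sqrt A + B) = A - B^2"
        using Apos by (simp add: algebra_simps power2_eq_square)
      also note AB
      also have "(2 * k2 * K + k3^2 / 9) * \<beta>^4 = (C1 * \<beta>^3) * (k2 / 2 * \<beta>)"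
        using k2 by (simp add: C1_def field_simps power3_eq_cube power4_eq_xxxx)
      finally show ?thesis using k2 \<beta> by (simp add: mult_le_cancel_right)
    qed
    have triangle: "\<bar>x - y - c * (p + q)\<bar> \<le> \<bar>x\<bar> + \<bar>y\<bar> + \<bar>c\<bar> * (\<bar>p\<bar> + \<bar>q\<bar>)"
      for x y c p q :: real
    proof -
      have "\<bar>c * (p + q)\<bar> \<le> \<bar>c\<bar> * (\<bar>p\<bar> + \<bar>q\<bar>)"
        unfolding abs_mult by (intro mult_left_mono abs_triangle_ineq abs_ge_zero)
      then show ?thesis by linarith
    qed
    have collect: "k * z + c * z + a * (k * z + d * z) = (k + c + a * (d + k)) * z" for k z c a d :: real
      by (simp add: algebra_simps)
    have "u - (sqrt A + 1/3 * (k3 / k2) * g) =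
      (u - (k2 * \<beta> + k3 / 2 * \<beta>^2)) - (sqrt A - B) - 
      k3 / (3 * k2) * ((g - (k2 / 2 * \<beta>^2 + k3 / 3 * \<beta>^3)) + k3 / 3 * \<beta>^3)"
      using k2 by (simp add: B_def field_simps power2_eq_square power3_eq_cube)
    also have "\<bar>\<dots>\<bar> \<le> \<bar>u - (k2 * \<beta> + k3 / 2 * \<beta>^2)\<bar> + \<bar>sqrt A - B\<bar> +
      \<bar>k3 / (3 * k2)\<bar> * (\<bar>g - (k2 / 2 * \<beta>^2 + k3 / 3 * \<beta>^3)\<bar> + \<bar>k3 / 3 * \<beta>^3\<bar>)"
      by (rule triangle)
    also have "\<dots> \<le> K * \<beta>^3 + C1 * \<beta>^3 + \<bar>k3\<bar> / (3 * k2) * (K * \<beta>^3 + \<bar>k3\<bar> / 3 * \<beta>^3)"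
    proof (intro add_mono mult_mono u sB)
      show "\<bar>g - (k2 / 2 * \<beta>^2 + k3 / 3 * \<beta>^3)\<bar> \<le> K * \<beta>^3"
        using order_trans[OF g mult_left_mono[OF p43 K]] .
    qed (use k2 \<beta> in \<open>auto simp: abs_mult\<close>)
    also have "\<dots> = C2 * \<beta>^3" unfolding C2_def by (rule collect)
    finally have 1: "\<bar>u - (sqrt A + 1/3 * (k3 / k2) * g)\<bar> \<le> C2 * \<beta>^3" .
    have "\<beta>^3 = (\<beta>^2) powr (3/2)" using \<beta> by (simp add: powr_powr flip: powr_numeral)
    also have "\<dots> \<le> (4 / k2 * g) powr (3/2)" 
      using glo k2 by (intro powr_mono2) (auto simp: field_simps)
    also have "\<dots> = (4 / k2) powr (3/2) * g powr (3/2)" using k2 gpos by (simp add: powr_mult powr_divide)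
    finally have 2: "\<beta>^3 \<le> (4 / k2) powr (3/2) * g powr (3/2)" .
    have 3: "sqrt A = sqrt (2 * k2) * g powr (1/2)"
      using gpos by (simp add: A_def real_sqrt_mult powr_half_sqrt)
    show ?thesis using order_trans[OF 1 mult_left_mono[OF 2 C2]] unfolding 3 by (simp add: mult.assoc)
  qed
  show ?thesis
    by (intro exI[of _ "C2 * (4 / k2) powr (3/2)"] exI[of _ b] conjI b allI impI main; elim conjE; assumption)
qed

section \<open>Densities of the measures in a divergence ball\<close>

lemma (in sigma_finite_measure) KL_div_density:
  fixes f :: "'a \<Rightarrow> real"
  assumes f [measurable]: "f \<in> borel_measurable M" and nn: "\<And>x. 0 \<le> f x"
  shows "KL_div (density M f) M =
    (if integrable M (\<lambda>x. f x * ln (f x)) then ereal (\<integral>x. f x * ln (f x) \<partial>M) else \<infinity>)"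
proof -
  have "density M (RN_deriv M (density M f)) = density M f"
    using f by (intro density_RN_deriv_density) auto
  then have eq: "AE x in M. RN_deriv M (density M f) x = f x"
    using f nn by (intro density_unique) auto
  have [measurable]: "entropy_density (exp 1) M (density M (\<lambda>x. ennreal (f x))) \<in> borel_measurable M"
    by (rule measurable_entropy_density)
  have log: "log (exp 1) = ln" by (simp add: fun_eq_iff log_def)
  have "AE x in M. f x * entropy_density (exp 1) M (density M (\<lambda>x. ennreal (f x))) x = f x * ln (f x)"
    using eq nn by (auto simp: entropy_density_def log)
  then have "integrable M (\<lambda>x. f x * entropy_density (exp 1) M (density M (\<lambda>x. ennreal (f x))) x)
     \<longleftrightarrow> integrable M (\<lambda>x. f x * ln (f x))"
    by (intro integrable_cong_AE) auto
  then have "integrable (density M f) (entropy_density (exp 1) M (density M f))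
     \<longleftrightarrow> integrable M (\<lambda>x. f x * ln (f x))"
    using nn by (subst integrable_real_density) auto
  moreover have "KL_divergence (exp 1) M (density M f) = (\<integral>x. f x * ln (f x) \<partial>M)"
    using KL_density[of "exp 1" f] nn by (simp add: log)
  ultimately show ?thesis by (simp add: KL_div_def)
qed

text \<open>
  Replaces a feasible measure by its real-valued density, so that the divergence constraint
  becomes a bound on an integral of \<open>f ln f\<close> over the reference measure.
\<close>

lemma KL_ball_densityE:
  assumes "sigma_finite_measure M" "P \<in> KL_ball M \<eta>"
  obtains f :: "'a \<Rightarrow> real" where
    "f \<in> borel_measurable M" "\<And>x. 0 \<le> f x" "P = density M f"
    "integrable M f" "(\<integral>x. f x \<partial>M) = 1"
    "integrable M (\<lambda>x. f x * ln (f x))" "(\<integral>x. f x * ln (f x) \<partial>M) \<le> \<eta>"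
proof -
  interpret sigma_finite_measure M by fact
  have P: "sets P = sets M" "prob_space P" "absolutely_continuous M P" "KL_div P M \<le> ereal \<eta>"
    using assms(2) by (auto simp: KL_ball_def ac_prob_measures_def)
  interpret P: prob_space P by fact
  obtain f where f [measurable]: "f \<in> borel_measurable M" and RN: "AE x in M. RN_deriv M P x = ennreal (f x)"
    and nn: "\<And>x. 0 \<le> f x"
    using real_RN_deriv[OF _ P(3,1)] P.finite_measure_axioms by metis
  have "density M f = density M (RN_deriv M P)"
    using RN by (intro density_cong) auto
  then have Peq: "P = density M f" using density_RN_deriv[OF P(3,1)] by simp
  have "(\<integral>\<^sup>+x. ennreal (f x) \<partial>M) = 1"
    using P.emeasure_space_1 unfolding Peq by (simp add: emeasure_density nn_integral_set_ennreal
       cong: nn_integral_cong)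
  then have "has_bochner_integral M f 1" 
    using nn by (intro has_bochner_integral_nn_integral) auto
  then have "integrable M f" "(\<integral>x. f x \<partial>M) = 1" by (auto simp: has_bochner_integral_iff)
  moreover have "integrable M (\<lambda>x. f x * ln (f x))" "(\<integral>x. f x * ln (f x) \<partial>M) \<le> \<eta>"
    using P(4) unfolding Peq KL_div_density[OF f nn] by (auto split: if_splits)
  ultimately show thesis using that f nn Peq by blast
qed

section \<open>Exponential moments and tilted moments\<close>

locale light_tailed = prob_space +
  fixes h :: "'a \<Rightarrow> real"
  assumes h [measurable]: "h \<in> borel_measurable M"
    and mgf_near_0: "\<exists>r>0. \<forall>\<theta>\<in>{-r<..<r}. integrable M (\<lambda>x. exp (\<theta> * h x))"
begin

abbreviation psi :: "real \<Rightarrow> real" where "psi \<equiv> log_mgf M h"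

abbreviation mgf_interior :: "real set" where "mgf_interior \<equiv> interior (log_mgf_domain M h)"

definition exp_moment :: "nat \<Rightarrow> real \<Rightarrow> real" where
  "exp_moment k \<beta> = (\<integral>x. h x ^ k * exp (\<beta> * h x) \<partial>M)"

text \<open>
  The moments of \<open>h\<close> under the exponentially tilted measure, whose density is proportional to
  \<open>exp (\<beta> h)\<close>.
\<close>

definition tilted_moment :: "nat \<Rightarrow> real \<Rightarrow> real" where
  "tilted_moment k \<beta> = exp_moment k \<beta> / exp_moment 0 \<beta>"

lemma zero_in_mgf_interior: "0 \<in> mgf_interior"
proof -
  obtain r where "0 < r" "{-r<..<r} \<subseteq> log_mgf_domain M h"
    using mgf_near_0 by (auto simp: log_mgf_domain_def)
  then show ?thesis by (intro interiorI[of "{-r<..<r}"]) auto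
qed

text \<open>
  Convexity allows the comparison of two solutions of the tilting equation anywhere in the
  domain, not only near 0.
\<close>

lemma convex_mgf_interior: "convex mgf_interior"
proof -
  have "is_interval (log_mgf_domain M h)"
    unfolding is_interval_1
  proof (intro ballI allI impI)
    fix s u t assume "s \<in> log_mgf_domain M h" "u \<in> log_mgf_domain M h" "s \<le> t \<and> t \<le> u"
    then have "integrable M (\<lambda>x. exp (s * h x) + exp (u * h x))"
      by (auto simp: log_mgf_domain_def)
    then have "integrable M (\<lambda>x. exp (t * h x))"
      by (rule Bochner_Integration.integrable_bound)
        (use exp_mult_le_endpoints[of s t u] \<open>s \<le> t \<and> t \<le> u\<close> in \<open>auto simp: add_nonneg_nonneg\<close>)
    then show "t \<in> log_mgf_domain M h" by (simp add: log_mgf_domain_def)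
  qed
  then show ?thesis by (simp add: is_interval_convex_1 convex_interior)
qed

lemma mgf_interior_ballE:
  assumes "t \<in> mgf_interior"
  obtains e where "0 < e" "cball t e \<subseteq> mgf_interior"
  using assms open_contains_cball open_interior by metis

text \<open>
  An interior point leaves room for a factor \<open>exp (e \<bar>h\<bar>)\<close>, which up to a constant
  dominates every power of \<open>\<bar>h\<bar>\<close> and which the two endpoint exponentials dominate in turn.
\<close>

lemma integrable_exp_moment:
  assumes "t \<in> mgf_interior"
  shows "integrable M (\<lambda>x. \<bar>h x\<bar> ^ k * exp (t * h x))" "integrable M (\<lambda>x. h x ^ k * exp (t * h x))"
proof -
  obtain e where e: "0 < e" "cball t e \<subseteq> mgf_interior" using mgf_interior_ballE[OF assms] .
  have "t - e \<in> mgf_interior" "t + e \<in> mgf_interior" using e by (auto simp: dist_real_def subset_iff)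
  then have "t - e \<in> log_mgf_domain M h" "t + e \<in> log_mgf_domain M h"
    by (auto dest: subsetD[OF interior_subset])
  then have int: "integrable M (\<lambda>x. real k ^ k / e ^ k * (exp ((t - e) * h x) + exp ((t + e) * h x)))"
    by (auto simp: log_mgf_domain_def)
  have bound: "\<bar>h x\<bar> ^ k * exp (t * h x) \<le> real k ^ k / e ^ k * (exp ((t - e) * h x) + exp ((t + e) * h x))" for x
  proof -
    have "(e * \<bar>h x\<bar>) ^ k \<le> real k ^ k * exp (e * \<bar>h x\<bar>)" using e by (intro power_le_exp) auto
    then have "\<bar>h x\<bar> ^ k \<le> real k ^ k / e ^ k * exp (e * \<bar>h x\<bar>)"
      using e by (simp add: power_mult_distrib field_simps)
    then have "\<bar>h x\<bar> ^ k * exp (t * h x) \<le> real k ^ k / e ^ k * exp (e * \<bar>h x\<bar>) * exp (t * h x)"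
      by (intro mult_right_mono) auto
    also have "\<dots> = real k ^ k / e ^ k * (exp (e * \<bar>h x\<bar>) * exp (t * h x))" by simp
    also have "\<dots> \<le> real k ^ k / e ^ k * (exp ((t - e) * h x) + exp ((t + e) * h x))"
    proof (intro mult_left_mono)
      show "exp (e * \<bar>h x\<bar>) * exp (t * h x) \<le> exp ((t - e) * h x) + exp ((t + e) * h x)"
        by (cases "0 \<le> h x") (auto simp: algebra_simps simp flip: exp_add)
    qed (use e in auto)
    finally show ?thesis .
  qed
  show 1: "integrable M (\<lambda>x. \<bar>h x\<bar> ^ k * exp (t * h x))"
    by (rule Bochner_Integration.integrable_bound[OF int])
       (use e(1) in \<open>auto intro!: AE_I2 order_trans[OF bound] simp: abs_mult power_abs\<close>)
  show "integrable M (\<lambda>x. h x ^ k * exp (t * h x))"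
    by (rule Bochner_Integration.integrable_bound[OF 1]) (auto simp: abs_mult power_abs)
qed

text \<open>
  Differentiation under the integral sign. The mean value bound for \<open>exp\<close> dominates the
  difference quotients at all points of a ball around \<open>t\<close> by the same two exponential moments
  of order \<open>k + 1\<close>, taken at the ends of that ball.
\<close>

lemma exp_moment_has_derivative:
  assumes t: "t \<in> mgf_interior"
  shows "(exp_moment k has_real_derivative exp_moment (Suc k) t) (at t)"
proof -
  obtain e where e: "0 < e" "cball t e \<subseteq> mgf_interior" using mgf_interior_ballE[OF t] .
  define w where "w x = \<bar>h x\<bar> ^ Suc k * exp ((t - e) * h x) + \<bar>h x\<bar> ^ Suc k * exp ((t + e) * h x)" for x
  have "t - e \<in> mgf_interior" "t + e \<in> mgf_interior" using e by (auto simp: dist_real_def subset_iff)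
  then have w: "integrable M w" 
    unfolding w_def by (intro Bochner_Integration.integrable_add integrable_exp_moment(1))
  define q where "q s x = h x ^ k * ((exp (s * h x) - exp (t * h x)) / (s - t))" for s x
  have bound: "\<bar>q s x\<bar> \<le> w x" if s: "s \<in> ball t e" "s \<noteq> t" for s x
  proof -
    have "exp (u * h x) \<le> exp ((t - e) * h x) + exp ((t + e) * h x)" if "u \<in> {s, t}" for u
      using that s by (intro exp_mult_le_endpoints) (auto simp: dist_real_def)
    then have m: "max (exp (s * h x)) (exp (t * h x)) \<le> exp ((t - e) * h x) + exp ((t + e) * h x)"
      by auto
    have "\<bar>exp (s * h x) - exp (t * h x)\<bar> \<le> \<bar>s * h x - t * h x\<bar> * max (exp (s * h x)) (exp (t * h x))"
      by (rule abs_exp_diff_le)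
    also have "\<dots> \<le> \<bar>s * h x - t * h x\<bar> * (exp ((t - e) * h x) + exp ((t + e) * h x))"
      by (intro mult_left_mono m) auto
    also have "\<bar>s * h x - t * h x\<bar> = \<bar>s - t\<bar> * \<bar>h x\<bar>" by (simp add: left_diff_distrib flip: abs_mult)
    finally have "\<bar>(exp (s * h x) - exp (t * h x)) / (s - t)\<bar> \<le> \<bar>h x\<bar> * (exp ((t - e) * h x) + exp ((t + e) * h x))"
      using s by (simp add: abs_divide pos_divide_le_eq mult_ac)
    then have "\<bar>h x\<bar> ^ k * \<bar>(exp (s * h x) - exp (t * h x)) / (s - t)\<bar> 
       \<le> \<bar>h x\<bar> ^ k * (\<bar>h x\<bar> * (exp ((t - e) * h x) + exp ((t + e) * h x)))"
      by (intro mult_left_mono) auto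
    then have "\<bar>q s x\<bar> \<le> \<bar>h x\<bar> ^ k * (\<bar>h x\<bar> * (exp ((t - e) * h x) + exp ((t + e) * h x)))"
      by (simp only: q_def abs_mult power_abs)
    then show ?thesis by (simp add: w_def algebra_simps)
  qed
  have lim: "(\<lambda>n. q (X n) x) \<longlonglongrightarrow> h x ^ Suc k * exp (t * h x)"
    if X: "\<And>n. X n \<in> ball t e - {t}" "X \<longlonglongrightarrow> t" for X x
  proof -
    have "((\<lambda>s. exp (s * h x)) has_real_derivative h x * exp (t * h x)) (at t)"
      by (auto intro!: derivative_eq_intros)
    then have "((\<lambda>s. (exp (s * h x) - exp (t * h x)) / (s - t)) \<longlongrightarrow> h x * exp (t * h x)) (at t)"
      by (simp add: has_field_derivative_iff)
    moreover have "filterlim X (at t) sequentially"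
      using X by (auto simp: filterlim_at)
    ultimately have "(\<lambda>n. (exp (X n * h x) - exp (t * h x)) / (X n - t)) \<longlonglongrightarrow> h x * exp (t * h x)"
      by (rule filterlim_compose)
    then have "(\<lambda>n. q (X n) x) \<longlonglongrightarrow> h x ^ k * (h x * exp (t * h x))"
      unfolding q_def by (rule tendsto_mult_left)
    then show ?thesis by (simp add: mult_ac)
  qed
  have quot: "(\<integral>x. q s x \<partial>M) = (exp_moment k s - exp_moment k t) / (s - t)" if s: "s \<in> ball t e" for s
  proof -
    have "s \<in> mgf_interior" using s e by auto
    have "q s x = (h x ^ k * exp (s * h x) - h x ^ k * exp (t * h x)) / (s - t)" for x
      by (simp add: q_def algebra_simps)
    then show ?thesis
      unfolding exp_moment_def using integrable_exp_moment(2)[OF \<open>s \<in> mgf_interior\<close>] integrable_exp_moment(2)[OF t]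
      by simp
  qed
  \<comment> \<open>Restricting the filter to the ball makes the domination hold for all terms of a sequence.\<close>
  have "((\<lambda>s. (exp_moment k s - exp_moment k t) / (s - t)) \<longlongrightarrow> exp_moment (Suc k) t) (at t within ball t e)"
    unfolding tendsto_at_iff_sequentially comp_def
  proof (intro allI impI)
    fix X :: "nat \<Rightarrow> real" assume X: "\<forall>i. X i \<in> ball t e - {t}" "X \<longlonglongrightarrow> t"
    have "(\<lambda>n. \<integral>x. q (X n) x \<partial>M) \<longlonglongrightarrow> (\<integral>x. h x ^ Suc k * exp (t * h x) \<partial>M)"
    proof (rule integral_dominated_convergence[OF _ _ w])
      show "AE x in M. (\<lambda>n. q (X n) x) \<longlonglongrightarrow> h x ^ Suc k * exp (t * h x)" 
        using lim X by blast
      show "AE x in M. norm (q (X n) x) \<le> w x" for n using bound X by (auto simp del: mem_ball)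
    qed (auto simp: q_def)
    then show "(\<lambda>n. (exp_moment k (X n) - exp_moment k t) / (X n - t)) \<longlonglongrightarrow> exp_moment (Suc k) t"
      using X quot by (simp add: exp_moment_def del: mem_ball)
  qed
  then have "(exp_moment k has_real_derivative exp_moment (Suc k) t) (at t within ball t e)"
    by (simp add: has_field_derivative_iff)
  then show ?thesis using at_within_open[of t "ball t e"] e by simp
qed

lemma mgf_pos:
  assumes "t \<in> mgf_interior" shows "0 < exp_moment 0 t"
proof -
  have int: "integrable M (\<lambda>x. exp (t * h x))" using integrable_exp_moment(2)[OF assms, of 0] by simp
  have "(\<integral>x. exp (t * h x) \<partial>M) \<noteq> 0"
    by (subst integral_nonneg_eq_0_iff_AE[OF int]) auto
  moreover have "0 \<le> (\<integral>x. exp (t * h x) \<partial>M)" by simp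
  ultimately have "0 < (\<integral>x. exp (t * h x) \<partial>M)" by linarith
  then show ?thesis by (simp add: exp_moment_def)
qed

text \<open>
  The tilted moments are closed under differentiation: the derivative of the \<open>k\<close>-th one is a
  tilted covariance, that of \<open>h ^ k\<close> and \<open>h\<close>. Hence all derivatives of \<open>psi\<close> are polynomials
  in tilted moments.
\<close>

lemma tilted_moment_has_derivative [derivative_intros]:
  assumes "(g has_real_derivative g') (at t within S)" "g t \<in> mgf_interior"
  shows "((\<lambda>s. tilted_moment k (g s)) has_real_derivative
    (tilted_moment (Suc k) (g t) - tilted_moment k (g t) * tilted_moment 1 (g t)) * g') (at t within S)"
proof -
  have "(tilted_moment k has_real_derivative
    (exp_moment (Suc k) (g t) * exp_moment 0 (g t) - exp_moment k (g t) * exp_moment (Suc 0) (g t)) 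
     / (exp_moment 0 (g t) * exp_moment 0 (g t))) (at (g t))"
    using mgf_pos[OF assms(2)] unfolding tilted_moment_def[abs_def]
    by (intro DERIV_divide exp_moment_has_derivative assms) auto
  also have "(exp_moment (Suc k) (g t) * exp_moment 0 (g t) - exp_moment k (g t) * exp_moment (Suc 0) (g t)) 
     / (exp_moment 0 (g t) * exp_moment 0 (g t)) = 
     tilted_moment (Suc k) (g t) - tilted_moment k (g t) * tilted_moment 1 (g t)"
    using mgf_pos[OF assms(2)] by (simp add: tilted_moment_def field_simps)
  finally show ?thesis using assms(1) by (rule DERIV_chain2)
qed

lemma psi_eq: "psi t = ln (exp_moment 0 t)"
  by (simp add: log_mgf_def exp_moment_def)

lemma psi_has_derivative:
  assumes "t \<in> mgf_interior" shows "(psi has_real_derivative tilted_moment 1 t) (at t)"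
proof -
  have "((\<lambda>t. ln (exp_moment 0 t)) has_real_derivative 1 / exp_moment 0 t * exp_moment (Suc 0) t) (at t)"
    by (intro derivative_intros DERIV_chain2[OF DERIV_ln_divide] exp_moment_has_derivative mgf_pos assms)
  then show ?thesis by (simp add: psi_eq[abs_def] tilted_moment_def)
qed

lemma deriv_psi: "t \<in> mgf_interior \<Longrightarrow> deriv psi t = tilted_moment 1 t"
  using psi_has_derivative DERIV_imp_deriv by blast

end

context light_tailed begin

lemma mgf_domain_subset: "t \<in> mgf_interior \<Longrightarrow> t \<in> log_mgf_domain M h"
  using interior_subset by blast

lemma exp_psi: "t \<in> mgf_interior \<Longrightarrow> exp (t * y - psi t) = exp (t * y) / exp_moment 0 t"
  using mgf_pos by (simp add: psi_eq exp_diff)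

lemma psi_0: "psi 0 = 0"
  by (simp add: log_mgf_def prob_space)

lemma tilted_moment_0: "tilted_moment k 0 = (\<integral>x. h x ^ k \<partial>M)"
  by (simp add: tilted_moment_def exp_moment_def prob_space)

lemma tilted_moment_eq_integral:
  assumes "t \<in> mgf_interior"
  shows "integrable M (\<lambda>x. exp (t * h x - psi t) * h x ^ k)"
    and "(\<integral>x. exp (t * h x - psi t) * h x ^ k \<partial>M) = tilted_moment k t"
  using integrable_exp_moment(2)[OF assms, of k]
  by (auto simp: exp_psi[OF assms] tilted_moment_def exp_moment_def mult.commute)

section \<open>Optimality of the tilted measure\<close>

text \<open>
  The easy half of the Donsker--Varadhan variational formula. For a feasible density \<open>f\<close>,
  Young's inequality with \<open>y = e \<bar>h\<bar>\<close> bounds \<open>f \<bar>h\<bar>\<close> by an integrable function, and with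
  \<open>y = t h - psi t\<close> it integrates to \<open>t E[h] - psi t \<le> D - 1 + 1\<close>, since both \<open>f\<close> and
  \<open>exp (t h - psi t)\<close> have integral 1.
\<close>

lemma donsker_varadhan:
  assumes P: "P \<in> KL_ball M \<eta>" 
  shows "integrable P h"
    and "t \<in> mgf_interior \<Longrightarrow> t * (\<integral>x. h x \<partial>P) \<le> \<eta> + psi t"
proof -
  obtain f where f [measurable]: "f \<in> borel_measurable M" and nn: "\<And>x. 0 \<le> f x" and Peq: "P = density M f"
    and int: "integrable M f" "(\<integral>x. f x \<partial>M) = 1"
    and ent: "integrable M (\<lambda>x. f x * ln (f x))" "(\<integral>x. f x * ln (f x) \<partial>M) \<le> \<eta>"
    using KL_ball_densityE[OF sigma_finite_measure_axioms P] by metis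
  obtain e where e: "0 < e" "cball 0 e \<subseteq> mgf_interior" 
    using mgf_interior_ballE[OF zero_in_mgf_interior] .
  have "e \<in> mgf_interior" "- e \<in> mgf_interior" using e by (auto simp: dist_real_def subset_iff)
  then have dom: "e \<in> log_mgf_domain M h" "- e \<in> log_mgf_domain M h"
    by (auto dest: mgf_domain_subset)
  have "integrable M (\<lambda>x. (f x * ln (f x) - f x + (exp (e * h x) + exp (- e * h x))) / e)"
    using dom int ent by (auto simp: log_mgf_domain_def)
  then have fh: "integrable M (\<lambda>x. f x * h x)"
  proof (rule Bochner_Integration.integrable_bound)
    have "\<bar>f x * h x\<bar> \<le> (f x * ln (f x) - f x + (exp (e * h x) + exp (- e * h x))) / e" for x
    proof -
      have "f x * (e * \<bar>h x\<bar>) \<le> f x * ln (f x) - f x + exp (e * \<bar>h x\<bar>)" by (rule entropy_exp_young[OF nn])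
      moreover have "exp (e * \<bar>h x\<bar>) \<le> exp (e * h x) + exp (- e * h x)" by (auto simp: abs_if)
      ultimately have "f x * (e * \<bar>h x\<bar>) \<le> f x * ln (f x) - f x + (exp (e * h x) + exp (- e * h x))"
        by linarith
      then show ?thesis using e nn[of x] by (simp add: abs_mult pos_le_divide_eq mult_ac)
    qed
    then show "AE x in M. norm (f x * h x) \<le> norm ((f x * ln (f x) - f x + (exp (e * h x) + exp (- e * h x))) / e)"
      by (intro AE_I2) (simp only: real_norm_def, rule order_trans[OF _ abs_ge_self])
  qed auto
  then show "integrable P h" unfolding Peq using nn by (subst integrable_real_density) auto
  have E: "(\<integral>x. h x \<partial>P) = (\<integral>x. f x * h x \<partial>M)" unfolding Peq using nn by (subst integral_real_density) auto
  show "t * (\<integral>x. h x \<partial>P) \<le> \<eta> + psi t" if t: "t \<in> mgf_interior"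
  proof -
    note tm = tilted_moment_eq_integral[OF t, of 0]
    have m0: "tilted_moment 0 t = 1" using mgf_pos[OF t] by (simp add: tilted_moment_def)
    have "(\<integral>x. f x * (t * h x - psi t) \<partial>M) \<le> (\<integral>x. f x * ln (f x) - f x + exp (t * h x - psi t) \<partial>M)"
    proof (rule integral_mono)
      show "integrable M (\<lambda>x. f x * (t * h x - psi t))"
        using fh int by (simp add: right_diff_distrib mult.left_commute[of _ t])
      show "integrable M (\<lambda>x. f x * ln (f x) - f x + exp (t * h x - psi t))"
        using tm int ent by simp
    qed (rule entropy_exp_young[OF nn])
    moreover have "(\<integral>x. f x * (t * h x - psi t) \<partial>M) = t * (\<integral>x. f x * h x \<partial>M) - psi t"
      using fh int by (simp add: right_diff_distrib mult.left_commute[of _ t])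
    moreover have "(\<integral>x. f x * ln (f x) - f x + exp (t * h x - psi t) \<partial>M) = (\<integral>x. f x * ln (f x) \<partial>M)"
      using tm int ent m0 by simp
    ultimately show ?thesis using ent unfolding E by linarith
  qed
qed

text \<open>
  The divergence of the tilted measure with parameter \<open>t\<close> from the reference measure.
  Equivalently, the Legendre transform of \<open>psi\<close> at the slope \<open>psi' t\<close>.
\<close>

definition tilted_KL :: "real \<Rightarrow> real" where
  "tilted_KL t = t * tilted_moment 1 t - psi t"

definition tilted_measure :: "real \<Rightarrow> 'a measure" where
  "tilted_measure t = density M (\<lambda>x. exp (t * h x - psi t))"

lemma tilted_measure_in_KL_ball:
  assumes t: "t \<in> mgf_interior"
  shows "tilted_measure t \<in> KL_ball M (tilted_KL t)"
    and "(\<integral>x. h x \<partial>tilted_measure t) = tilted_moment 1 t"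
proof -
  have m0: "tilted_moment 0 t = 1" using mgf_pos[OF t] by (simp add: tilted_moment_def)
  note tm0 = tilted_moment_eq_integral[OF t, of 0] and tm1 = tilted_moment_eq_integral[OF t, of 1]
  have "(\<integral>\<^sup>+x. ennreal (exp (t * h x - psi t)) \<partial>M) = ennreal (\<integral>x. exp (t * h x - psi t) \<partial>M)"
    using tm0 by (intro nn_integral_eq_integral) auto
  then have "(\<integral>\<^sup>+x. ennreal (exp (t * h x - psi t)) \<partial>M) = 1" using tm0 m0 by simp
  then have "prob_space (tilted_measure t)"
    by (intro prob_spaceI) (simp add: tilted_measure_def emeasure_density cong: nn_integral_cong)
  moreover have "absolutely_continuous M (tilted_measure t)"
    unfolding tilted_measure_def by (intro absolutely_continuousI_density) auto
  moreover have "KL_div (tilted_measure t) M = ereal (tilted_KL t)"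
  proof -
    have "integrable M (\<lambda>x. exp (t * h x - psi t) * (t * h x - psi t))"
      using tm0 tm1 by (simp add: right_diff_distrib mult.left_commute[of _ t])
    moreover have "(\<integral>x. exp (t * h x - psi t) * (t * h x - psi t) \<partial>M) = tilted_KL t"
      using tm0 tm1 m0 by (simp add: right_diff_distrib mult.left_commute[of _ t] tilted_KL_def)
    ultimately show ?thesis unfolding tilted_measure_def by (subst KL_div_density) auto
  qed
  ultimately show "tilted_measure t \<in> KL_ball M (tilted_KL t)"
    by (auto simp: KL_ball_def ac_prob_measures_def tilted_measure_def)
  show "(\<integral>x. h x \<partial>tilted_measure t) = tilted_moment 1 t"
    unfolding tilted_measure_def using tm1 by (subst integral_real_density) auto
qed

lemma tilt_solution_iff:
  "tilt_solution M h \<eta> \<beta> \<longleftrightarrow> 0 < \<beta> \<and> \<beta> \<in> mgf_interior \<and> tilted_KL \<beta> = \<eta>"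
  by (auto simp: tilt_solution_def tilted_KL_def deriv_psi)

text \<open>
  When the tilted measure exhausts the divergence budget, its mean
  \<open>(\<eta> + psi \<beta>) / \<beta>\<close> equals the Donsker--Varadhan upper bound with the same parameter. This needs
  \<open>\<beta> > 0\<close> to divide by.
\<close>

lemma tilted_measure_optimal:
  assumes "tilt_solution M h \<eta> \<beta>"
  shows "is_arg_max (\<lambda>P. integral\<^sup>L P h) (\<lambda>P. P \<in> KL_ball M \<eta>) (tilted_measure \<beta>)"
    and "max_expectation M h \<eta> = tilted_moment 1 \<beta>"
proof -
  have \<beta>: "0 < \<beta>" "\<beta> \<in> mgf_interior" "tilted_KL \<beta> = \<eta>" using assms by (auto simp: tilt_solution_iff)
  note opt = tilted_measure_in_KL_ball[OF \<beta>(2), unfolded \<beta>(3)]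
  have upper: "(\<integral>x. h x \<partial>P) \<le> tilted_moment 1 \<beta>" if "P \<in> KL_ball M \<eta>" for P
  proof -
    have "\<beta> * (\<integral>x. h x \<partial>P) \<le> \<beta> * tilted_moment 1 \<beta>"
      using donsker_varadhan(2)[OF that \<beta>(2)] \<beta>(3) by (simp add: tilted_KL_def)
    then show ?thesis using \<beta>(1) by simp
  qed
  show "is_arg_max (\<lambda>P. integral\<^sup>L P h) (\<lambda>P. P \<in> KL_ball M \<eta>) (tilted_measure \<beta>)"
    using opt upper by (auto simp: is_arg_max_def not_less)
  show "max_expectation M h \<eta> = tilted_moment 1 \<beta>"
    unfolding max_expectation_def
  proof (rule Greatest_equality)
    show "tilted_moment 1 \<beta> \<in> (\<lambda>P. integral\<^sup>L P h) ` KL_ball M \<eta>"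
      using opt by (metis imageI)
  qed (use upper in blast)
qed

section \<open>Taylor expansions along the tilting curve\<close>

text \<open>
  The first four derivatives of \<open>psi\<close>, that is the cumulants of \<open>h\<close> under the tilted measure,
  written in terms of its raw moments.
\<close>

definition psi_deriv :: "nat \<Rightarrow> real \<Rightarrow> real" where
  "psi_deriv k t = (let m = (\<lambda>i. tilted_moment i t) in
     [psi t, m 1, m 2 - m 1 ^ 2, m 3 - 3 * m 1 * m 2 + 2 * m 1 ^ 3,
      m 4 - 4 * m 1 * m 3 - 3 * m 2 ^ 2 + 12 * m 1 ^ 2 * m 2 - 6 * m 1 ^ 4] ! k)"

lemma psi_deriv_has_derivative:
  assumes "t \<in> mgf_interior" "k < 4"
  shows "(psi_deriv k has_real_derivative psi_deriv (Suc k) t) (at t)"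
proof -
  note [simp] = psi_deriv_def[abs_def] numeral_2_eq_2 numeral_3_eq_3 eval_nat_numeral
  consider "k = 0" | "k = 1" | "k = 2" | "k = 3" using assms(2) by linarith
  then show ?thesis
  proof cases
    case 1
    then show ?thesis using psi_has_derivative[OF assms(1)] by simp
  qed (use assms(1) in \<open>auto intro!: derivative_eq_intros simp: algebra_simps\<close>)
qed

lemma psi_deriv_at_0:
  shows "psi_deriv 0 0 = 0" "psi_deriv 1 0 = integral\<^sup>L M h"
    "psi_deriv 2 0 = central_moment M h 2" "psi_deriv 3 0 = central_moment M h 3"
proof -
  define c where "c = integral\<^sup>L M h"
  have int: "integrable M (\<lambda>x. h x ^ k)" for k
    using integrable_exp_moment(2)[OF zero_in_mgf_interior, of k] by simp
  have int1: "integrable M h" using int[of 1] by simp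
  have "central_moment M h 2 = (\<integral>x. h x ^ 2 - 2 * c * h x + c ^ 2 \<partial>M)"
    unfolding central_moment_def c_def[symmetric]
    by (intro Bochner_Integration.integral_cong) (auto simp: power2_eq_square algebra_simps)
  also have "\<dots> = (\<integral>x. h x ^ 2 \<partial>M) - c ^ 2"
    using int[of 2] int1 by (simp add: prob_space flip: c_def) (simp add: power2_eq_square)
  finally show "psi_deriv 2 0 = central_moment M h 2"
    by (simp add: psi_deriv_def tilted_moment_0 c_def numeral_2_eq_2)
  have "central_moment M h 3 = (\<integral>x. h x ^ 3 - 3 * c * h x ^ 2 + 3 * c ^ 2 * h x - c ^ 3 \<partial>M)"
    unfolding central_moment_def c_def[symmetric]
    by (intro Bochner_Integration.integral_cong) (auto simp: power2_eq_square power3_eq_cube algebra_simps)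
  also have "\<dots> = (\<integral>x. h x ^ 3 \<partial>M) - 3 * c * (\<integral>x. h x ^ 2 \<partial>M) + 2 * c ^ 3"
    using int[of 2] int[of 3] int1
    by (simp add: prob_space flip: c_def) (simp add: power2_eq_square power3_eq_cube)
  finally show "psi_deriv 3 0 = central_moment M h 3"
    by (simp add: psi_deriv_def tilted_moment_0 c_def numeral_3_eq_3)
qed (simp_all add: psi_deriv_def psi_0 tilted_moment_0)

text \<open>
  Maclaurin's formula for \<open>psi\<close> to order 4 and for \<open>psi'\<close> to order 3. Both remainders involve
  the fourth derivative, which is bounded on the compact interval. In
  \<open>\<beta> psi' \<beta> - psi \<beta>\<close> the linear terms cancel, which makes \<open>\<eta>\<close> quadratic in \<open>\<beta>\<close> and is the
  origin of the square root in the final expansion.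
\<close>

lemma taylor_bounds:
  assumes "0 < b" "{0..b} \<subseteq> mgf_interior"
  shows "\<exists>K\<ge>0. \<forall>\<beta>. 0 < \<beta> \<and> \<beta> \<le> b \<longrightarrow>
    \<bar>(tilted_moment 1 \<beta> - integral\<^sup>L M h)
       - (central_moment M h 2 * \<beta> + central_moment M h 3 / 2 * \<beta>^2)\<bar> \<le> K * \<beta>^3 \<and>
    \<bar>tilted_KL \<beta> - (central_moment M h 2 / 2 * \<beta>^2 + central_moment M h 3 / 3 * \<beta>^3)\<bar> \<le> K * \<beta>^4"
proof -
  have "continuous_on {0..b} (psi_deriv 4)"
  proof (rule continuous_at_imp_continuous_on, intro ballI)
    fix t assume "t \<in> {0..b}"
    then have t: "t \<in> mgf_interior" using assms by auto
    have "isCont (tilted_moment k) t" for k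
      using tilted_moment_has_derivative[OF DERIV_ident, of t k] t by (auto intro: DERIV_isCont)
    then show "isCont (psi_deriv 4) t"
      by (auto simp: psi_deriv_def[abs_def] eval_nat_numeral intro!: continuous_intros)
  qed
  then have "bounded (psi_deriv 4 ` {0..b})"
    by (intro compact_imp_bounded compact_continuous_image) auto
  then obtain K where K: "0 < K" "\<And>t. t \<in> {0..b} \<Longrightarrow> \<bar>psi_deriv 4 t\<bar> \<le> K"
    by (auto simp: bounded_pos)
  have "\<bar>(tilted_moment 1 \<beta> - integral\<^sup>L M h)
       - (central_moment M h 2 * \<beta> + central_moment M h 3 / 2 * \<beta>^2)\<bar> \<le> K * \<beta>^3 \<and>
    \<bar>tilted_KL \<beta> - (central_moment M h 2 / 2 * \<beta>^2 + central_moment M h 3 / 3 * \<beta>^3)\<bar> \<le> K * \<beta>^4"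
    if \<beta>: "0 < \<beta>" "\<beta> \<le> b" for \<beta>
  proof -
    have D: "(psi_deriv k has_real_derivative psi_deriv (Suc k) t) (at t)"
      if "k < 4" "0 \<le> t" "t \<le> \<beta>" for k t
      using that \<beta> assms by (intro psi_deriv_has_derivative) auto
    obtain s where s: "0 < s" "s < \<beta>" and psi_s:
      "psi_deriv 0 \<beta> = (\<Sum>m<4. psi_deriv m 0 / fact m * \<beta> ^ m) + psi_deriv 4 s / fact 4 * \<beta> ^ 4"
      using Maclaurin[of \<beta> 4 psi_deriv "psi_deriv 0"] D \<beta> by auto
    obtain r where r: "0 < r" "r < \<beta>" and psi_r:
      "psi_deriv 1 \<beta> = (\<Sum>m<3. psi_deriv (Suc m) 0 / fact m * \<beta> ^ m) + psi_deriv (Suc 3) r / fact 3 * \<beta> ^ 3"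
      using Maclaurin[of \<beta> 3 "\<lambda>m. psi_deriv (Suc m)" "psi_deriv 1"] D \<beta> by auto
    define v w \<mu> k2 k3 where "v = psi_deriv 4 s" "w = psi_deriv 4 r" "\<mu> = integral\<^sup>L M h"
      "k2 = central_moment M h 2" "k3 = central_moment M h 3"
    note defs = this
    have vw: "\<bar>v\<bar> \<le> K" "\<bar>w\<bar> \<le> K" using K(2) r s \<beta> by (auto simp: defs)
    have psi: "psi \<beta> = \<mu> * \<beta> + k2 / 2 * \<beta>^2 + k3 / 6 * \<beta>^3 + v / 24 * \<beta>^4"
      using psi_s psi_deriv_at_0 unfolding defs
      by (simp add: eval_nat_numeral psi_deriv_def[of 0 \<beta>])
    have m1: "tilted_moment 1 \<beta> = \<mu> + k2 * \<beta> + k3 / 2 * \<beta>^2 + w / 6 * \<beta>^3"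
      using psi_r psi_deriv_at_0 unfolding defs
      by (simp add: eval_nat_numeral psi_deriv_def[of "Suc 0" \<beta>])
    have 1: "tilted_moment 1 \<beta> - \<mu> - (k2 * \<beta> + k3 / 2 * \<beta>^2) = w / 6 * \<beta>^3"
      unfolding m1 by simp
    have 2: "tilted_KL \<beta> - (k2 / 2 * \<beta>^2 + k3 / 3 * \<beta>^3) = (w / 6 - v / 24) * \<beta>^4"
      unfolding tilted_KL_def m1 psi by (simp add: field_simps power2_eq_square power3_eq_cube power4_eq_xxxx)
    have "\<bar>w / 6\<bar> \<le> K" "\<bar>w / 6 - v / 24\<bar> \<le> K" using vw by (auto simp: abs_if split: if_splits)
    then have "\<bar>w / 6 * \<beta>^3\<bar> \<le> K * \<beta>^3" "\<bar>(w / 6 - v / 24) * \<beta>^4\<bar> \<le> K * \<beta>^4"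
      using \<beta> unfolding abs_mult by (auto intro!: mult_right_mono)
    then show ?thesis unfolding defs(3-5)[symmetric] 1 2 by blast
  qed
  then show ?thesis using K(1) by (intro exI[of _ K]) auto
qed

end

section \<open>Solving the tilting equation\<close>

locale nondegenerate_light_tailed = light_tailed +
  assumes nonconstant: "\<not> (\<exists>c. AE x in M. h x = c)"
begin

text \<open>
  The tilted measure has the same null sets as the reference measure, so \<open>h\<close> is not almost
  surely constant under it either.
\<close>

lemma tilted_variance_pos:
  assumes t: "t \<in> mgf_interior"
  shows "0 < tilted_moment 2 t - tilted_moment 1 t ^ 2"
proof -
  define c where "c = tilted_moment 1 t"
  define p where "p x = exp (t * h x - psi t)" for x
  have [measurable]: "p \<in> borel_measurable M" unfolding p_def by measurable
  note tm = tilted_moment_eq_integral[OF t, folded p_def]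
  have m0: "tilted_moment 0 t = 1" using mgf_pos[OF t] by (simp add: tilted_moment_def)
  have eq: "p x * (h x - c)^2 = p x * h x ^ 2 - 2 * c * (p x * h x) + c^2 * p x" for x
    by (simp add: power2_eq_square algebra_simps)
  have p: "integrable M p" "integrable M (\<lambda>x. p x * h x)" "integrable M (\<lambda>x. p x * h x ^ 2)"
    using tm(1)[of 0] tm(1)[of 1] tm(1)[of 2] by simp_all
  have int: "integrable M (\<lambda>x. p x * (h x - c)^2)"
    unfolding eq using p by simp
  have "(\<integral>x. p x * (h x - c)^2 \<partial>M)
      = (\<integral>x. p x * h x ^ 2 \<partial>M) - 2 * c * (\<integral>x. p x * h x \<partial>M) + c^2 * (\<integral>x. p x \<partial>M)"
    unfolding eq using p by simp
  also have "\<dots> = tilted_moment 2 t - tilted_moment 1 t ^ 2"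
    using tm(2)[of 0] tm(2)[of 1] tm(2)[of 2] m0 by (simp add: c_def power2_eq_square)
  finally have "(\<integral>x. p x * (h x - c)^2 \<partial>M) = tilted_moment 2 t - tilted_moment 1 t ^ 2" .
  moreover have "(\<integral>x. p x * (h x - c)^2 \<partial>M) \<noteq> 0"
  proof
    assume "(\<integral>x. p x * (h x - c)^2 \<partial>M) = 0"
    then have "AE x in M. p x * (h x - c)^2 = 0"
      by (subst (asm) integral_nonneg_eq_0_iff_AE[OF int]) (auto simp: p_def)
    then have "AE x in M. h x = c" by (auto simp: p_def)
    then show False using nonconstant by blast
  qed
  moreover have "0 \<le> (\<integral>x. p x * (h x - c)^2 \<partial>M)" by (simp add: p_def)
  ultimately show ?thesis by linarith
qed

lemma tilted_KL_has_derivative: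
  assumes "t \<in> mgf_interior"
  shows "(tilted_KL has_real_derivative t * (tilted_moment 2 t - tilted_moment 1 t ^ 2)) (at t)"
  using assms unfolding tilted_KL_def[abs_def]
  by (auto intro!: derivative_eq_intros psi_has_derivative simp: numeral_2_eq_2)

lemma tilted_KL_0: "tilted_KL 0 = 0"
  by (simp add: tilted_KL_def psi_0)

lemma continuous_tilted_KL: "S \<subseteq> mgf_interior \<Longrightarrow> continuous_on S tilted_KL"
  using tilted_KL_has_derivative DERIV_isCont by (blast intro: continuous_at_imp_continuous_on)

text \<open>
  The derivative of \<open>t psi' t - psi t\<close> is \<open>t psi'' t\<close>, and \<open>psi''\<close> is the tilted variance.
  At 0 the derivative vanishes, so positivity is used on the open interval only.
\<close>

lemma tilted_KL_strict_mono:
  assumes "s \<in> mgf_interior" "t \<in> mgf_interior" "0 \<le> s" "s < t"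
  shows "tilted_KL s < tilted_KL t"
proof -
  have sub: "{s..t} \<subseteq> mgf_interior"
    using convex_mgf_interior assms closed_segment_subset[of s mgf_interior t]
    by (simp add: closed_segment_eq_real_ivl)
  show ?thesis
  proof (rule DERIV_pos_imp_increasing_open[OF \<open>s < t\<close>])
    fix x assume "s < x" "x < t"
    then have "x \<in> mgf_interior" "0 < x" using sub assms by auto
    then show "\<exists>y. (tilted_KL has_real_derivative y) (at x) \<and> 0 < y"
      using tilted_KL_has_derivative tilted_variance_pos by (meson mult_pos_pos)
  qed (rule continuous_tilted_KL[OF sub])
qed

lemma tilt_solution_unique:
  assumes "tilt_solution M h \<eta> \<beta>" "tilt_solution M h \<eta> \<beta>'"
  shows "\<beta> = \<beta>'"
  using assms tilted_KL_strict_mono[of \<beta> \<beta>'] tilted_KL_strict_mono[of \<beta>' \<beta>]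
  by (cases \<beta> \<beta>' rule: linorder_cases) (auto simp: tilt_solution_iff)

text \<open>
  The bound \<open>\<beta> \<le> b\<close> with \<open>b\<close> arbitrarily small says that the solution tends to 0 with \<open>\<eta>\<close>;
  the expansion relies on it.
\<close>

lemma tilt_solution_exists:
  assumes b: "0 < b" "{0..b} \<subseteq> mgf_interior"
  shows "\<forall>\<^sub>F \<eta> in at_right 0. \<exists>\<beta>\<le>b. tilt_solution M h \<eta> \<beta>"
proof -
  have "0 < tilted_KL b" using tilted_KL_strict_mono[of 0 b] b by (auto simp: tilted_KL_0 subset_iff)
  then have "\<forall>\<^sub>F \<eta> in at_right 0. \<eta> \<in> {0<..<tilted_KL b}" by (rule eventually_at_right_real)
  then show ?thesis
  proof eventually_elim
    case (elim \<eta>)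
    then obtain \<beta> where "0 \<le> \<beta>" "\<beta> \<le> b" "tilted_KL \<beta> = \<eta>"
      using IVT'[of tilted_KL 0 \<eta> b] continuous_tilted_KL[OF b(2)] b(1) by (auto simp: tilted_KL_0)
    moreover from this have "\<beta> \<noteq> 0" using elim by (auto simp: tilted_KL_0)
    ultimately show ?case using b by (auto simp: tilt_solution_iff intro!: exI[of _ \<beta>])
  qed
qed

section \<open>The optimal value for small divergence budgets\<close>

lemma max_expectation_expansion:
  "(\<lambda>\<eta>. max_expectation M h \<eta>
      - (integral\<^sup>L M h
         + sqrt (2 * central_moment M h 2) * \<eta> powr (1/2)
         + 1/3 * (central_moment M h 3 / central_moment M h 2) * \<eta>))
    \<in> O[at_right 0](\<lambda>\<eta>. \<eta> powr (3/2))"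
proof -
  obtain e where e: "0 < e" "cball 0 e \<subseteq> mgf_interior"
    using mgf_interior_ballE[OF zero_in_mgf_interior] .
  have sub: "{0..e} \<subseteq> mgf_interior" using e by (auto simp: dist_real_def subset_iff)
  have k2: "0 < central_moment M h 2"
    using tilted_variance_pos[OF zero_in_mgf_interior] psi_deriv_at_0(3)
    by (simp add: psi_deriv_def numeral_2_eq_2)
  obtain K where "0 \<le> K" and K: "\<And>\<beta>. 0 < \<beta> \<Longrightarrow> \<beta> \<le> e \<Longrightarrow>
    \<bar>(tilted_moment 1 \<beta> - integral\<^sup>L M h)
       - (central_moment M h 2 * \<beta> + central_moment M h 3 / 2 * \<beta>^2)\<bar> \<le> K * \<beta>^3 \<and>
    \<bar>tilted_KL \<beta> - (central_moment M h 2 / 2 * \<beta>^2 + central_moment M h 3 / 3 * \<beta>^3)\<bar> \<le> K * \<beta>^4"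
    using taylor_bounds[OF e(1) sub] by auto
  obtain C b where b: "0 < b" and C: "\<And>\<beta> u g. 0 < \<beta> \<Longrightarrow> \<beta> \<le> b \<Longrightarrow>
    \<bar>u - (central_moment M h 2 * \<beta> + central_moment M h 3 / 2 * \<beta>^2)\<bar> \<le> K * \<beta>^3 \<Longrightarrow>
    \<bar>g - (central_moment M h 2 / 2 * \<beta>^2 + central_moment M h 3 / 3 * \<beta>^3)\<bar> \<le> K * \<beta>^4 \<Longrightarrow>
    \<bar>u - (sqrt (2 * central_moment M h 2) * g powr (1/2)
       + 1/3 * (central_moment M h 3 / central_moment M h 2) * g)\<bar> \<le> C * g powr (3/2)"
    using parametric_sqrt_expansion[OF k2 \<open>0 \<le> K\<close>, of "central_moment M h 3"] by blast
  have "\<forall>\<^sub>F \<eta> in at_right 0. \<exists>\<beta>\<le>min e b. tilt_solution M h \<eta> \<beta>"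
    using e b sub by (intro tilt_solution_exists) auto
  then show ?thesis
  proof (intro bigoI[where c = C], eventually_elim)
    case (elim \<eta>)
    then obtain \<beta> where \<beta>: "\<beta> \<le> e" "\<beta> \<le> b" and sol: "tilt_solution M h \<eta> \<beta>" by auto
    have "0 < \<beta>" "tilted_KL \<beta> = \<eta>" using sol by (auto simp: tilt_solution_iff)
    then show ?case
      using C[of \<beta> "tilted_moment 1 \<beta> - integral\<^sup>L M h" \<eta>] K[of \<beta>] \<beta>
      unfolding tilted_measure_optimal(2)[OF sol] by (simp add: algebra_simps)
  qed
qed

end

theorem theorem3p1:
  fixes P0 :: "'a measure" and h :: "'a \<Rightarrow> real"
  assumes "prob_space P0"
    and "h \<in> borel_measurable P0"
    and "\<exists>r>0. \<forall>\<theta>\<in>{-r<..<r}. integrable P0 (\<lambda>x. exp (\<theta> * h x))"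
    and "\<not> (\<exists>c. AE x in P0. h x = c)"
  shows "(\<forall>\<^sub>F \<eta> in at_right 0.
            (\<forall>P\<in>KL_ball P0 \<eta>. integrable P h) \<and>
            (\<exists>P. is_arg_max (\<lambda>P. integral\<^sup>L P h) (\<lambda>P. P \<in> KL_ball P0 \<eta>) P) \<and>
            (\<exists>!\<beta>. tilt_solution P0 h \<eta> \<beta>) \<and>
            (\<forall>\<beta>. tilt_solution P0 h \<eta> \<beta> \<longrightarrow>
               log_mgf P0 h differentiable (at \<beta>) \<and>
               max_expectation P0 h \<eta> = deriv (log_mgf P0 h) \<beta>))
       \<and> (\<lambda>\<eta>. max_expectation P0 h \<eta>
             - (integral\<^sup>L P0 h
                + sqrt (2 * central_moment P0 h 2) * \<eta> powr (1/2)
                + 1/3 * (central_moment P0 h 3 / central_moment P0 h 2) * \<eta>))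
         \<in> O[at_right 0](\<lambda>\<eta>. \<eta> powr (3/2))"
proof -
  interpret prob_space P0 by fact
  interpret nondegenerate_light_tailed P0 h
    by unfold_locales (use assms in auto)
  obtain e where e: "0 < e" "cball 0 e \<subseteq> mgf_interior"
    using mgf_interior_ballE[OF zero_in_mgf_interior] .
  have "{0..e} \<subseteq> mgf_interior" using e by (auto simp: dist_real_def subset_iff)
  with e(1) have "\<forall>\<^sub>F \<eta> in at_right 0. \<exists>\<beta>\<le>e. tilt_solution P0 h \<eta> \<beta>"
    by (rule tilt_solution_exists)
  then show ?thesis
  proof (intro conjI max_expectation_expansion, eventually_elim)
    case (elim \<eta>)
    then obtain \<beta> where sol: "tilt_solution P0 h \<eta> \<beta>" by blast
    have "psi differentiable (at \<beta>') \<and> max_expectation P0 h \<eta> = deriv psi \<beta>'"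
      if "tilt_solution P0 h \<eta> \<beta>'" for \<beta>'
      using that psi_has_derivative deriv_psi tilted_measure_optimal(2)
      by (auto simp: tilt_solution_iff real_differentiable_def)
    then show ?case
      using donsker_varadhan(1) tilted_measure_optimal(1)[OF sol] sol tilt_solution_unique by blast
  qed
qed

end
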